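(* Let $(R,\triangleright)$ be a rack. Then the lattice $\mathcal{R}(R)$ of subracks of $R$ is distributive if and only if the corresponding quandle $(\overline{R},* )$ of $R$ is the trivial quandle.
   Context: A rack is a set $R$ with a binary operation $\triangleright$ such that (i) $a\triangleright(b\triangleright c)=(a\triangleright b)\triangleright(a\triangleright c)$ for all $a,b,c\in R$, and (ii) for all $a,b\in R$ there is a unique $c\in R$ with $a\triangleright c=b$. A quandle is a rack in which $a\triangleright a=a$ for all $a$; a quandle is trivial if $a\triangleright b=b$ for all $a,b$. A subset $Q\subseteq R$ is a subrack if $(Q,\triangleright)$ is a rack; the empty set counts as a subrack. $\mathcal{R}(R)$ is the lattice of all subracks of $R$ ordered by inclusion. A lattice $L$ is distributive if $a\wedge(b\vee c)=(a\wedge b)\vee(a\wedge c)$ for all $a,b,c\in L$. For $a\in R$, $\ll a\gg$ denotes the intersection of all subracks of $R$ containing $a$. Define the equivalence relation $a\sim b$ on $R$ by $\ll a\gg=\ll b\gg$, and let $\overline{a}$ denote the class of $a$. The corresponding quandle of $R$ is the set $\overline{R}=\{\overline{a}:\ a\in R\}$ with the (well-defined) operation $\overline{a}*\overline{b}=\overline{a\triangleright b}$; it is a quandle. *)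

theory Defs
  imports "HOL-Algebra.Complete_Lattice"
begin

locale rack =
  fixes R :: "'a set" and rack_op :: "'a \<Rightarrow> 'a \<Rightarrow> 'a" (infixr \<open>\<rhd>\<close> 65)
  assumes op_closed: "\<lbrakk>a \<in> R; b \<in> R\<rbrakk> \<Longrightarrow> a \<rhd> b \<in> R"
    and self_distrib: "\<lbrakk>a \<in> R; b \<in> R; c \<in> R\<rbrakk> \<Longrightarrow> a \<rhd> (b \<rhd> c) = (a \<rhd> b) \<rhd> (a \<rhd> c)"
    and unique_left_div: "\<lbrakk>a \<in> R; b \<in> R\<rbrakk> \<Longrightarrow> \<exists>!c. c \<in> R \<and> a \<rhd> c = b"

locale quandle = rack +
  assumes op_idem: "a \<in> R \<Longrightarrow> a \<rhd> a = a"

locale trivial_quandle = quandle +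
  assumes op_trivial: "\<lbrakk>a \<in> R; b \<in> R\<rbrakk> \<Longrightarrow> a \<rhd> b = b"

text \<open>The empty set is a subrack. Since \<open>rack Q\<close> asks for the left quotients to exist
  inside \<open>Q\<close>, closure under the operation alone is not enough.\<close>

definition subrack :: "'a set \<Rightarrow> 'a set \<Rightarrow> ('a \<Rightarrow> 'a \<Rightarrow> 'a) \<Rightarrow> bool"
  where "subrack Q R f \<longleftrightarrow> Q \<subseteq> R \<and> rack Q f"

definition subrack_lattice :: "'a set \<Rightarrow> ('a \<Rightarrow> 'a \<Rightarrow> 'a) \<Rightarrow> 'a set gorder"
  where "subrack_lattice R f = \<lparr>carrier = {Q. subrack Q R f}, eq = (=), le = (\<subseteq>)\<rparr>"

locale distributive_lattice = lattice L for L (structure) +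
  assumes meet_join_distrib:
    "\<lbrakk>a \<in> carrier L; b \<in> carrier L; c \<in> carrier L\<rbrakk>
      \<Longrightarrow> a \<sqinter> (b \<squnion> c) = (a \<sqinter> b) \<squnion> (a \<sqinter> c)"

definition gen_subrack :: "'a set \<Rightarrow> ('a \<Rightarrow> 'a \<Rightarrow> 'a) \<Rightarrow> 'a \<Rightarrow> 'a set"
  where "gen_subrack R f a = \<Inter> {Q. subrack Q R f \<and> a \<in> Q}"

definition gen_rel :: "'a set \<Rightarrow> ('a \<Rightarrow> 'a \<Rightarrow> 'a) \<Rightarrow> ('a \<times> 'a) set"
  where "gen_rel R f = {(a, b). a \<in> R \<and> b \<in> R \<and> gen_subrack R f a = gen_subrack R f b}"

definition corr_carrier :: "'a set \<Rightarrow> ('a \<Rightarrow> 'a \<Rightarrow> 'a) \<Rightarrow> 'a set set"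
  where "corr_carrier R f = R // gen_rel R f"

text \<open>Lifted to classes by a union over representatives, as in \<open>UN_equiv_class2\<close>; by
  \<open>corr_op_class\<close> below all the sets in the union coincide.\<close>

definition corr_op :: "'a set \<Rightarrow> ('a \<Rightarrow> 'a \<Rightarrow> 'a) \<Rightarrow> 'a set \<Rightarrow> 'a set \<Rightarrow> 'a set"
  where "corr_op R f A B = (\<Union>a\<in>A. \<Union>b\<in>B. gen_rel R f `` {f a b})"

context rack
begin

lemma left_cancel: "\<lbrakk>a \<in> R; b \<in> R; c \<in> R; a \<rhd> b = a \<rhd> c\<rbrakk> \<Longrightarrow> b = c"
  using unique_left_div[of a "a \<rhd> c"] op_closed[of a c] by blast

lemma left_div: "\<lbrakk>a \<in> R; b \<in> R\<rbrakk> \<Longrightarrow> \<exists>c\<in>R. a \<rhd> c = b"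
  using unique_left_div by blast

lemma subrack_iff:
  "subrack Q R (\<rhd>) \<longleftrightarrow>
    Q \<subseteq> R \<and> (\<forall>a\<in>Q. \<forall>b\<in>Q. a \<rhd> b \<in> Q) \<and> (\<forall>a\<in>Q. \<forall>c\<in>R. a \<rhd> c \<in> Q \<longrightarrow> c \<in> Q)"
  (is "?l \<longleftrightarrow> ?r")
proof
  assume ?l
  then have QR: "Q \<subseteq> R" and "rack Q (\<rhd>)" by (auto simp: subrack_def)
  interpret Q: rack Q "(\<rhd>)" by fact
  have div: "c \<in> Q" if ac: "a \<in> Q" "c \<in> R" "a \<rhd> c \<in> Q" for a c
  proof -
    obtain d where "d \<in> Q" "a \<rhd> d = a \<rhd> c" using Q.left_div[OF ac(1,3)] by blast
    then show ?thesis using left_cancel[of a d c] QR ac by (metis subsetD)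
  qed
  show ?r
    by (intro conjI ballI impI QR) (rule Q.op_closed, assumption+, erule (2) div)
next
  assume r: ?r
  have "rack Q (\<rhd>)"
  proof
    fix a b assume ab: "a \<in> Q" "b \<in> Q"
    show "a \<rhd> b \<in> Q" using r ab by blast
    have abR: "a \<in> R" "b \<in> R" using r ab by blast+
    obtain c where c: "c \<in> R" "a \<rhd> c = b" using left_div[OF abR] by auto
    have "c \<in> Q" using c r ab by metis
    moreover have "d = c" if "d \<in> Q" "a \<rhd> d = b" for d
      using left_cancel[of a d c] that c abR r by (metis subsetD)
    ultimately show "\<exists>!c. c \<in> Q \<and> a \<rhd> c = b" using c by blast
  next
    fix a b c assume "a \<in> Q" "b \<in> Q" "c \<in> Q"
    then show "a \<rhd> (b \<rhd> c) = (a \<rhd> b) \<rhd> (a \<rhd> c)" using self_distrib[of a b c] conjunct1[OF r] by (simp add: subset_iff)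
  qed
  then show ?l using r by (simp add: subrack_def)
qed

lemma subrack_subset: "\<lbrakk>subrack Q R (\<rhd>); a \<in> Q\<rbrakk> \<Longrightarrow> a \<in> R"
  unfolding subrack_def by (elim conjE) (rule subsetD)

lemma subrack_closed: "\<lbrakk>subrack Q R (\<rhd>); a \<in> Q; b \<in> Q\<rbrakk> \<Longrightarrow> a \<rhd> b \<in> Q"
  unfolding subrack_def by (elim conjE) (rule rack.op_closed)

lemma subrack_div: "\<lbrakk>subrack Q R (\<rhd>); a \<in> Q; a \<rhd> c \<in> Q; c \<in> R\<rbrakk> \<Longrightarrow> c \<in> Q"
  unfolding subrack_iff by (elim conjE) (drule (1) bspec, drule (1) bspec, erule (1) mp)

lemma subrack_self: "subrack R R (\<rhd>)"
  by (simp add: subrack_def rack_axioms)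

lemma subrack_Inter:
  assumes "\<And>Q. Q \<in> F \<Longrightarrow> subrack Q R (\<rhd>)"
  shows "subrack (R \<inter> \<Inter> F) R (\<rhd>)"
  unfolding subrack_iff
proof (intro conjI ballI impI)
  fix a b assume "a \<in> R \<inter> \<Inter> F" "b \<in> R \<inter> \<Inter> F"
  then show "a \<rhd> b \<in> R \<inter> \<Inter> F" using assms by (auto intro: op_closed subrack_closed)
next
  fix a b assume "a \<in> R \<inter> \<Inter> F" "b \<in> R" "a \<rhd> b \<in> R \<inter> \<Inter> F"
  then show "b \<in> R \<inter> \<Inter> F" using assms by (auto intro: subrack_div)
qed auto

lemma gen_subrack_eq:
  "a \<in> R \<Longrightarrow> gen_subrack R (\<rhd>) a = R \<inter> \<Inter> {Q. subrack Q R (\<rhd>) \<and> a \<in> Q}"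
  unfolding gen_subrack_def
  by (rule sym, rule Int_absorb1, rule Inter_lower) (simp add: subrack_self)

lemma subrack_gen: "a \<in> R \<Longrightarrow> subrack (gen_subrack R (\<rhd>) a) R (\<rhd>)"
  by (simp only: gen_subrack_eq) (rule subrack_Inter, simp)

lemma gen_mem: "a \<in> gen_subrack R (\<rhd>) a"
  by (simp add: gen_subrack_def)

lemma gen_least: "\<lbrakk>subrack Q R (\<rhd>); a \<in> Q\<rbrakk> \<Longrightarrow> gen_subrack R (\<rhd>) a \<subseteq> Q"
  unfolding gen_subrack_def by (rule Inter_lower) simp

lemma gen_sub: "a \<in> R \<Longrightarrow> gen_subrack R (\<rhd>) a \<subseteq> R"
  by (rule gen_least[OF subrack_self])

lemma complete_lattice_subracks: "complete_lattice (subrack_lattice R (\<rhd>))"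
proof -
  interpret partial_order "subrack_lattice R (\<rhd>)"
    by unfold_locales (auto simp: subrack_lattice_def)
  have glb: "is_glb (subrack_lattice R (\<rhd>)) (R \<inter> \<Inter> A) A"
    if "A \<subseteq> carrier (subrack_lattice R (\<rhd>))" for A
  proof -
    have "subrack (R \<inter> \<Inter> A) R (\<rhd>)"
      using that by (intro subrack_Inter) (auto simp: subrack_lattice_def)
    then show ?thesis
      using that subrack_subset by (simp add: greatest_def Lower_def subrack_lattice_def) blast
  qed
  have lub: "is_lub (subrack_lattice R (\<rhd>)) (R \<inter> \<Inter> {Q. subrack Q R (\<rhd>) \<and> \<Union> A \<subseteq> Q}) A"
    if "A \<subseteq> carrier (subrack_lattice R (\<rhd>))" for A
  proof -
    have "subrack (R \<inter> \<Inter> {Q. subrack Q R (\<rhd>) \<and> \<Union> A \<subseteq> Q}) R (\<rhd>)"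
      by (intro subrack_Inter) auto
    then show ?thesis
      using that subrack_subset by (simp add: least_def Upper_def subrack_lattice_def) blast
  qed
  show ?thesis by unfold_locales (blast intro: glb lub)+
qed

lemma gen_same_action:
  assumes a: "a \<in> R" and b: "b \<in> gen_subrack R (\<rhd>) a" and x: "x \<in> R"
  shows "b \<rhd> x = a \<rhd> x"
proof -
  let ?Q = "{b \<in> R. \<forall>x\<in>R. b \<rhd> x = a \<rhd> x}"
  have "subrack ?Q R (\<rhd>)"
    unfolding subrack_iff
  proof (intro conjI ballI impI)
    fix b c assume bc: "b \<in> ?Q" "c \<in> ?Q"
    have "(b \<rhd> c) \<rhd> x = a \<rhd> x" if x: "x \<in> R" for x
    proof -
      obtain y where y: "y \<in> R" "b \<rhd> y = x" using left_div[of b x] bc x by blast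
      have "(b \<rhd> c) \<rhd> x = b \<rhd> (c \<rhd> y)" using self_distrib[of b c y] y bc by simp
      also have "c \<rhd> y = x" using y bc by simp
      finally show ?thesis using bc x by simp
    qed
    then show "b \<rhd> c \<in> ?Q" using bc op_closed a by simp
  next
    fix b c assume bc: "b \<in> ?Q" "c \<in> R" "b \<rhd> c \<in> ?Q"
    have "c \<rhd> y = a \<rhd> y" if "y \<in> R" for y
    proof -
      have "a \<rhd> (c \<rhd> y) = b \<rhd> (c \<rhd> y)" using bc that op_closed by simp
      also have "\<dots> = (b \<rhd> c) \<rhd> (b \<rhd> y)" using self_distrib[of b c y] bc that by simp
      also have "\<dots> = a \<rhd> (b \<rhd> y)" using bc that op_closed a by simp
      also have "\<dots> = a \<rhd> (a \<rhd> y)" using bc that a by simp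
      finally show ?thesis using left_cancel[OF a, of "c \<rhd> y" "a \<rhd> y"] op_closed a bc that by simp
    qed
    then show "c \<in> ?Q" using bc by auto
  qed auto
  then have "gen_subrack R (\<rhd>) a \<subseteq> ?Q" using gen_least a by blast
  then show ?thesis using b x by blast
qed

lemma subrack_preimage:
  assumes c: "c \<in> R" and Q: "subrack Q R (\<rhd>)"
  shows "subrack {x \<in> R. c \<rhd> x \<in> Q} R (\<rhd>)"
  unfolding subrack_iff
proof (intro conjI ballI impI)
  fix a b assume "a \<in> {x \<in> R. c \<rhd> x \<in> Q}" "b \<in> {x \<in> R. c \<rhd> x \<in> Q}"
  then show "a \<rhd> b \<in> {x \<in> R. c \<rhd> x \<in> Q}"
    using c self_distrib[of c a b] subrack_closed[OF Q] by (simp add: op_closed)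
next
  fix a b assume "a \<in> {x \<in> R. c \<rhd> x \<in> Q}" "b \<in> R" "a \<rhd> b \<in> {x \<in> R. c \<rhd> x \<in> Q}"
  then show "b \<in> {x \<in> R. c \<rhd> x \<in> Q}"
    using c self_distrib[of c a b] subrack_div[OF Q, of "c \<rhd> a" "c \<rhd> b"]
    by (simp add: op_closed)
qed auto

lemma subrack_image:
  assumes c: "c \<in> R" and Q: "subrack Q R (\<rhd>)"
  shows "subrack ((\<rhd>) c ` Q) R (\<rhd>)"
proof -
  have QR: "\<And>x. x \<in> Q \<Longrightarrow> x \<in> R" using subrack_subset[OF Q] .
  show ?thesis
    unfolding subrack_iff
  proof (intro conjI ballI impI)
    show "(\<rhd>) c ` Q \<subseteq> R" using QR op_closed c by auto
  next
    fix a b assume "a \<in> (\<rhd>) c ` Q" "b \<in> (\<rhd>) c ` Q"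
    then obtain x y where "x \<in> Q" "y \<in> Q" "a = c \<rhd> x" "b = c \<rhd> y" by blast
    moreover have "a \<rhd> b = c \<rhd> (x \<rhd> y)" using calculation self_distrib c QR by auto
    moreover have "x \<rhd> y \<in> Q" using calculation subrack_closed[OF Q] by simp
    ultimately show "a \<rhd> b \<in> (\<rhd>) c ` Q" by blast
  next
    fix a b assume a: "a \<in> (\<rhd>) c ` Q" and b: "b \<in> R" and ab: "a \<rhd> b \<in> (\<rhd>) c ` Q"
    obtain x z where xz: "x \<in> Q" "z \<in> Q" "a = c \<rhd> x" "a \<rhd> b = c \<rhd> z" using a ab by blast
    obtain y where y: "y \<in> R" "c \<rhd> y = b" using left_div[OF c b] by auto
    have "c \<rhd> (x \<rhd> y) = c \<rhd> z" using self_distrib[of c x y] xz y c QR[of x] by simp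
    then have "x \<rhd> y = z" using left_cancel[of c "x \<rhd> y" z] c QR xz y op_closed[of x y] by simp
    then have "y \<in> Q" using xz y subrack_div[OF Q, of x y] by simp
    then show "b \<in> (\<rhd>) c ` Q" using y by blast
  qed
qed

lemma gen_translate:
  assumes c: "c \<in> R" and b: "b \<in> R"
  shows "gen_subrack R (\<rhd>) (c \<rhd> b) = (\<rhd>) c ` gen_subrack R (\<rhd>) b"
proof
  show "gen_subrack R (\<rhd>) (c \<rhd> b) \<subseteq> (\<rhd>) c ` gen_subrack R (\<rhd>) b"
    using gen_least[OF subrack_image[OF c subrack_gen[OF b]]] gen_mem by blast
  have "gen_subrack R (\<rhd>) b \<subseteq> {x \<in> R. c \<rhd> x \<in> gen_subrack R (\<rhd>) (c \<rhd> b)}"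
    using b c gen_mem op_closed by (intro gen_least subrack_preimage subrack_gen) auto
  then show "(\<rhd>) c ` gen_subrack R (\<rhd>) b \<subseteq> gen_subrack R (\<rhd>) (c \<rhd> b)" by blast
qed

lemma gen_square:
  assumes a: "a \<in> R"
  shows "gen_subrack R (\<rhd>) (a \<rhd> a) = gen_subrack R (\<rhd>) a"
proof
  have aa: "a \<rhd> a \<in> gen_subrack R (\<rhd>) a"
    using subrack_closed[OF subrack_gen[OF a]] gen_mem by simp
  then show "gen_subrack R (\<rhd>) (a \<rhd> a) \<subseteq> gen_subrack R (\<rhd>) a"
    using gen_least subrack_gen a by blast
  have sr: "subrack (gen_subrack R (\<rhd>) (a \<rhd> a)) R (\<rhd>)" using subrack_gen op_closed a by blast
  have "(a \<rhd> a) \<rhd> a = a \<rhd> a" using gen_same_action aa a by blast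
  then have "a \<in> gen_subrack R (\<rhd>) (a \<rhd> a)"
    using subrack_div[OF sr, of "a \<rhd> a" a] a gen_mem[of "a \<rhd> a"] by simp
  then show "gen_subrack R (\<rhd>) a \<subseteq> gen_subrack R (\<rhd>) (a \<rhd> a)"
    using gen_least sr by blast
qed

lemma equiv_gen_rel: "equiv R (gen_rel R (\<rhd>))"
  by (auto simp: gen_rel_def intro!: equivI refl_onI symI transI)

lemma gen_rel_op:
  assumes "(a, a') \<in> gen_rel R (\<rhd>)" "(b, b') \<in> gen_rel R (\<rhd>)"
  shows "(a \<rhd> b, a' \<rhd> b') \<in> gen_rel R (\<rhd>)"
proof -
  have *: "a \<in> R" "a' \<in> R" "b \<in> R" "b' \<in> R" "gen_subrack R (\<rhd>) a = gen_subrack R (\<rhd>) a'"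
    "gen_subrack R (\<rhd>) b = gen_subrack R (\<rhd>) b'"
    using assms by (auto simp: gen_rel_def)
  have "a' \<rhd> b' = a \<rhd> b'" using gen_same_action[of a a' b'] * gen_mem[of a'] by simp
  then show ?thesis using * op_closed gen_translate by (simp add: gen_rel_def)
qed

lemma corr_op_class:
  assumes "a \<in> R" "b \<in> R"
  shows "corr_op R (\<rhd>) (gen_rel R (\<rhd>) `` {a}) (gen_rel R (\<rhd>) `` {b}) = gen_rel R (\<rhd>) `` {a \<rhd> b}"
  unfolding corr_op_def
  using assms equiv_gen_rel equiv_gen_rel gen_rel_op
  by (intro UN_equiv_class2) (auto intro!: congruent2I' equiv_class_eq[OF equiv_gen_rel])

lemma class_eq_iff:
  assumes "a \<in> R" "b \<in> R"
  shows "gen_rel R (\<rhd>) `` {a} = gen_rel R (\<rhd>) `` {b}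
    \<longleftrightarrow> gen_subrack R (\<rhd>) a = gen_subrack R (\<rhd>) b"
  using eq_equiv_class_iff[OF equiv_gen_rel assms] assms by (simp add: gen_rel_def)

lemma quandle_corr: "quandle (corr_carrier R (\<rhd>)) (corr_op R (\<rhd>))"
proof
  fix A B assume "A \<in> corr_carrier R (\<rhd>)" "B \<in> corr_carrier R (\<rhd>)"
  then obtain a b where ab: "a \<in> R" "b \<in> R"
    and AB: "A = gen_rel R (\<rhd>) `` {a}" "B = gen_rel R (\<rhd>) `` {b}"
    unfolding corr_carrier_def by (meson quotientE)
  show "corr_op R (\<rhd>) A B \<in> corr_carrier R (\<rhd>)"
    by (simp add: AB ab corr_op_class corr_carrier_def quotientI op_closed)
  obtain c where c: "c \<in> R" "a \<rhd> c = b" using left_div[OF ab] by auto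
  show "\<exists>!C. C \<in> corr_carrier R (\<rhd>) \<and> corr_op R (\<rhd>) A C = B"
  proof (intro ex1I conjI; (elim conjE)?)
    show "gen_rel R (\<rhd>) `` {c} \<in> corr_carrier R (\<rhd>)"
      by (simp add: c corr_carrier_def quotientI)
    show "corr_op R (\<rhd>) A (gen_rel R (\<rhd>) `` {c}) = B"
      by (simp add: c ab AB corr_op_class)
    fix D assume D: "D \<in> corr_carrier R (\<rhd>)" "corr_op R (\<rhd>) A D = B"
    then obtain d where d: "d \<in> R" "D = gen_rel R (\<rhd>) `` {d}"
      unfolding corr_carrier_def by (meson quotientE)
    have "gen_subrack R (\<rhd>) (a \<rhd> d) = gen_subrack R (\<rhd>) (a \<rhd> c)"
      using D(2) ab c d by (simp add: AB corr_op_class class_eq_iff op_closed)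
    then have im: "(\<rhd>) a ` gen_subrack R (\<rhd>) d = (\<rhd>) a ` gen_subrack R (\<rhd>) c"
      by (simp only: gen_translate ab c(1) d(1))
    have "inj_on ((\<rhd>) a) R" by (rule inj_onI, rule left_cancel[OF ab(1)])
    then have "gen_subrack R (\<rhd>) d = gen_subrack R (\<rhd>) c"
      using im inj_on_image_eq_iff[OF _ gen_sub[OF d(1)] gen_sub[OF c(1)]] by blast
    then show "D = gen_rel R (\<rhd>) `` {c}" using class_eq_iff[OF d(1) c(1)] by (simp add: d(2))
  qed
next
  fix A B C
  assume "A \<in> corr_carrier R (\<rhd>)" "B \<in> corr_carrier R (\<rhd>)" "C \<in> corr_carrier R (\<rhd>)"
  then obtain a b c where "a \<in> R" "b \<in> R" "c \<in> R" "A = gen_rel R (\<rhd>) `` {a}"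
    "B = gen_rel R (\<rhd>) `` {b}" "C = gen_rel R (\<rhd>) `` {c}"
    unfolding corr_carrier_def by (meson quotientE)
  then show "corr_op R (\<rhd>) A (corr_op R (\<rhd>) B C)
      = corr_op R (\<rhd>) (corr_op R (\<rhd>) A B) (corr_op R (\<rhd>) A C)"
    by (simp add: corr_op_class op_closed self_distrib[symmetric])
next
  fix A assume "A \<in> corr_carrier R (\<rhd>)"
  then obtain a where "a \<in> R" "A = gen_rel R (\<rhd>) `` {a}"
    unfolding corr_carrier_def by (meson quotientE)
  then show "corr_op R (\<rhd>) A A = A"
    by (simp add: corr_op_class class_eq_iff gen_square op_closed)
qed

end

end

theory Submission
  imports Defs
begin

text \<open>
  Write \<open>\<langle>a\<rangle>\<close> for the subrack generated by \<open>a\<close>. Since the operation of the corresponding quandle is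
  computed on representatives, its triviality says that \<open>\<langle>a \<rhd> b\<rangle> = \<langle>b\<rangle>\<close> for all \<open>a, b\<close>
  (\<open>trivial_corr_iff\<close>). In words: acting by an element never moves \<open>b\<close> across the boundary of a
  subrack.

  If this holds, the union of two subracks is again a subrack (\<open>subrack_Un\<close>), because \<open>a \<rhd> b\<close> and
  \<open>b\<close> always lie in the same subracks. Then meet and join are intersection and union, and these
  distribute.

  Conversely, \<open>a \<rhd> b\<close> lies in \<open>\<langle>a\<rangle> \<squnion> \<langle>b\<rangle>\<close> and, by division, \<open>b\<close> lies in \<open>\<langle>a\<rangle> \<squnion> \<langle>a \<rhd> b\<rangle>\<close>. In a
  distributive lattice \<open>\<langle>c\<rangle> \<sqsubseteq> \<langle>a\<rangle> \<squnion> \<langle>d\<rangle>\<close> splits as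
  \<open>\<langle>c\<rangle> = (\<langle>c\<rangle> \<sqinter> \<langle>a\<rangle>) \<squnion> (\<langle>c\<rangle> \<sqinter> \<langle>d\<rangle>)\<close>, so \<open>\<langle>c\<rangle> \<subseteq> \<langle>d\<rangle>\<close> as soon as \<open>\<langle>c\<rangle>\<close> and \<open>\<langle>a\<rangle>\<close> are disjoint
  (\<open>distributive_gen_subset\<close>). Applied to both memberships, this gives \<open>\<langle>a \<rhd> b\<rangle> = \<langle>b\<rangle>\<close> whenever
  \<open>\<langle>a\<rangle>\<close> is disjoint from \<open>\<langle>a \<rhd> b\<rangle>\<close> and from \<open>\<langle>b\<rangle>\<close>. If one of these intersections is nonempty,
  then, as all elements of \<open>\<langle>x\<rangle>\<close> act like \<open>x\<close>, the elements \<open>a\<close> and \<open>b\<close> act in the same way, and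
  \<open>\<langle>a \<rhd> b\<rangle> = \<langle>b \<rhd> b\<rangle> = \<langle>b\<rangle>\<close>.
\<close>

context rack
begin

lemma trivial_corr_iff:
  "trivial_quandle (corr_carrier R (\<rhd>)) (corr_op R (\<rhd>)) \<longleftrightarrow>
    (\<forall>a\<in>R. \<forall>b\<in>R. gen_subrack R (\<rhd>) (a \<rhd> b) = gen_subrack R (\<rhd>) b)" (is "?t \<longleftrightarrow> ?g")
proof
  assume ?t
  then interpret T: trivial_quandle "corr_carrier R (\<rhd>)" "corr_op R (\<rhd>)" .
  show ?g
  proof (intro ballI)
    fix a b assume ab: "a \<in> R" "b \<in> R"
    have "corr_op R (\<rhd>) (gen_rel R (\<rhd>) `` {a}) (gen_rel R (\<rhd>) `` {b}) = gen_rel R (\<rhd>) `` {b}"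
      using ab by (intro T.op_trivial) (simp_all add: corr_carrier_def quotientI)
    then show "gen_subrack R (\<rhd>) (a \<rhd> b) = gen_subrack R (\<rhd>) b"
      using ab by (simp add: corr_op_class class_eq_iff op_closed)
  qed
next
  assume g: ?g
  interpret Q: quandle "corr_carrier R (\<rhd>)" "corr_op R (\<rhd>)" by (rule quandle_corr)
  show ?t
  proof unfold_locales
    fix A B assume "A \<in> corr_carrier R (\<rhd>)" "B \<in> corr_carrier R (\<rhd>)"
    then obtain a b where "a \<in> R" "b \<in> R"
      "A = gen_rel R (\<rhd>) `` {a}" "B = gen_rel R (\<rhd>) `` {b}"
      unfolding corr_carrier_def by (meson quotientE)
    then show "corr_op R (\<rhd>) A B = B"
      using g by (simp add: corr_op_class class_eq_iff op_closed)
  qed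
qed

lemma subrack_Int:
  assumes "subrack A R (\<rhd>)" "subrack B R (\<rhd>)"
  shows "subrack (A \<inter> B) R (\<rhd>)"
proof -
  have "R \<inter> \<Inter> {A, B} = A \<inter> B" using assms(1) by (auto simp: subrack_def)
  moreover have "subrack (R \<inter> \<Inter> {A, B}) R (\<rhd>)"
    by (rule subrack_Inter) (use assms in \<open>elim insertE emptyE; simp\<close>)
  ultimately show ?thesis by simp
qed

lemma subrack_empty: "subrack {} R (\<rhd>)"
  by (simp add: subrack_iff)

lemma subrack_Un:
  assumes g: "\<And>a b. \<lbrakk>a \<in> R; b \<in> R\<rbrakk> \<Longrightarrow> gen_subrack R (\<rhd>) (a \<rhd> b) = gen_subrack R (\<rhd>) b"
    and A: "subrack A R (\<rhd>)" and B: "subrack B R (\<rhd>)"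
  shows "subrack (A \<union> B) R (\<rhd>)"
proof -
  have move: "a \<rhd> b \<in> Q \<longleftrightarrow> b \<in> Q" if "subrack Q R (\<rhd>)" "a \<in> R" "b \<in> R" for Q a b
  proof
    assume "a \<rhd> b \<in> Q"
    from gen_least[OF that(1) this] show "b \<in> Q"
      using gen_mem[of b] g[OF that(2,3)] by (simp add: subset_iff)
  next
    assume "b \<in> Q"
    from gen_least[OF that(1) this] show "a \<rhd> b \<in> Q"
      using gen_mem[of "a \<rhd> b"] g[OF that(2,3)] by (simp add: subset_iff)
  qed
  have sub: "A \<union> B \<subseteq> R" using A B by (simp add: subrack_def)
  have move_Un: "a \<rhd> b \<in> A \<union> B \<longleftrightarrow> b \<in> A \<union> B" if "a \<in> R" "b \<in> R" for a b
    using move[OF A that] move[OF B that] by simp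
  show ?thesis
    unfolding subrack_iff
  proof (intro conjI ballI impI sub)
    show "a \<rhd> b \<in> A \<union> B" if "a \<in> A \<union> B" "b \<in> A \<union> B" for a b
      using move_Un[of a b] that subsetD[OF sub] by simp
    show "c \<in> A \<union> B" if "a \<in> A \<union> B" "c \<in> R" "a \<rhd> c \<in> A \<union> B" for a c
      using move_Un[of a c] that subsetD[OF sub] by simp
  qed
qed

lemma carrier_subrack_lattice:
  "Q \<in> carrier (subrack_lattice R (\<rhd>)) \<longleftrightarrow> subrack Q R (\<rhd>)"
  by (simp add: subrack_lattice_def)

lemma le_subrack_lattice: "A \<sqsubseteq>\<^bsub>subrack_lattice R (\<rhd>)\<^esub> B \<longleftrightarrow> A \<subseteq> B"
  by (simp add: subrack_lattice_def)

lemma lattice_subracks: "lattice (subrack_lattice R (\<rhd>))"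
proof -
  interpret complete_lattice "subrack_lattice R (\<rhd>)" by (rule complete_lattice_subracks)
  show ?thesis by (rule lattice_axioms)
qed

lemma meet_subracks:
  assumes A: "subrack A R (\<rhd>)" and B: "subrack B R (\<rhd>)"
  shows "A \<sqinter>\<^bsub>subrack_lattice R (\<rhd>)\<^esub> B = A \<inter> B"
proof -
  interpret L: lattice "subrack_lattice R (\<rhd>)" by (rule lattice_subracks)
  show ?thesis
    using L.meet_left[of A B] L.meet_right[of A B] L.meet_le[of "A \<inter> B" A B]
      A B subrack_Int[OF A B]
    by (simp add: carrier_subrack_lattice le_subrack_lattice subset_antisym)
qed

lemma subrack_join:
  assumes A: "subrack A R (\<rhd>)" and B: "subrack B R (\<rhd>)"
  shows "subrack (A \<squnion>\<^bsub>subrack_lattice R (\<rhd>)\<^esub> B) R (\<rhd>)"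
proof -
  interpret L: lattice "subrack_lattice R (\<rhd>)" by (rule lattice_subracks)
  show ?thesis using L.join_closed[of A B] A B by (simp add: carrier_subrack_lattice)
qed

lemma Un_subset_join_subracks:
  assumes A: "subrack A R (\<rhd>)" and B: "subrack B R (\<rhd>)"
  shows "A \<union> B \<subseteq> A \<squnion>\<^bsub>subrack_lattice R (\<rhd>)\<^esub> B"
proof -
  interpret L: lattice "subrack_lattice R (\<rhd>)" by (rule lattice_subracks)
  show ?thesis
    using L.join_left[of A B] L.join_right[of A B] A B
    by (simp add: carrier_subrack_lattice le_subrack_lattice)
qed

lemma join_subracks_least:
  assumes A: "subrack A R (\<rhd>)" and B: "subrack B R (\<rhd>)" and C: "subrack C R (\<rhd>)"
    and sub: "A \<union> B \<subseteq> C"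
  shows "A \<squnion>\<^bsub>subrack_lattice R (\<rhd>)\<^esub> B \<subseteq> C"
proof -
  interpret L: lattice "subrack_lattice R (\<rhd>)" by (rule lattice_subracks)
  show ?thesis
    using L.join_le[of A C B] A B C sub
    by (simp add: carrier_subrack_lattice le_subrack_lattice)
qed

lemma same_action_if_gen_meet:
  assumes "a \<in> R" "b \<in> R" "x \<in> R"
    and "gen_subrack R (\<rhd>) a \<inter> gen_subrack R (\<rhd>) b \<noteq> {}"
  shows "a \<rhd> x = b \<rhd> x"
proof -
  obtain z where z: "z \<in> gen_subrack R (\<rhd>) a" "z \<in> gen_subrack R (\<rhd>) b"
    using assms(4) by blast
  show ?thesis
    using gen_same_action[OF assms(1) z(1) assms(3)] gen_same_action[OF assms(2) z(2) assms(3)]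
    by simp
qed

text \<open>Equality of the actions of \<open>a\<close> and \<open>b\<close> at the single point \<open>b\<close> replaces \<open>a \<rhd> b\<close> by the
  square \<open>b \<rhd> b\<close>, which generates the same subrack as \<open>b\<close>.\<close>

lemma gen_op_if_gen_meet:
  assumes a: "a \<in> R" and b: "b \<in> R"
    and meet: "gen_subrack R (\<rhd>) a \<inter> gen_subrack R (\<rhd>) b \<noteq> {}"
  shows "gen_subrack R (\<rhd>) (a \<rhd> b) = gen_subrack R (\<rhd>) b"
  using same_action_if_gen_meet[OF a b b meet] gen_square[OF b] by simp

text \<open>By self-distributivity \<open>a \<rhd> b\<close> acts as the conjugate of the action of \<open>b\<close> by that of \<open>a\<close>. If
  the conjugate coincides with the action of \<open>a\<close>, then so does the action of \<open>b\<close>.\<close>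

lemma gen_op_if_gen_op_meet:
  assumes a: "a \<in> R" and b: "b \<in> R"
    and meet: "gen_subrack R (\<rhd>) a \<inter> gen_subrack R (\<rhd>) (a \<rhd> b) \<noteq> {}"
  shows "gen_subrack R (\<rhd>) (a \<rhd> b) = gen_subrack R (\<rhd>) b"
proof -
  have "a \<rhd> (a \<rhd> b) = (a \<rhd> b) \<rhd> (a \<rhd> b)"
    using a b by (intro same_action_if_gen_meet[OF _ _ _ meet] op_closed)
  also have "\<dots> = a \<rhd> (b \<rhd> b)" using self_distrib[OF a b b] by simp
  finally have "a \<rhd> b = b \<rhd> b"
    using left_cancel[OF a, of "a \<rhd> b" "b \<rhd> b"] a b by (simp add: op_closed)
  then show ?thesis using gen_square[OF b] by simp
qed

text \<open>The empty subrack is the bottom element, so when the meet with \<open>\<langle>a\<rangle>\<close> is empty only the meet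
  with \<open>\<langle>d\<rangle>\<close> is left in the distributed join. The membership of \<open>c\<close> in \<open>\<langle>a\<rangle> \<squnion> \<langle>d\<rangle>\<close> is
  expressed through all subracks containing \<open>a\<close> and \<open>d\<close>, so that closure covers \<open>c = a \<rhd> d\<close> and
  left division covers \<open>d = a \<rhd> c\<close>.\<close>

lemma distributive_gen_subset:
  assumes dist: "distributive_lattice (subrack_lattice R (\<rhd>))"
    and aR: "a \<in> R" and cR: "c \<in> R" and dR: "d \<in> R"
    and mem: "\<And>Q. \<lbrakk>subrack Q R (\<rhd>); a \<in> Q; d \<in> Q\<rbrakk> \<Longrightarrow> c \<in> Q"
    and disj: "gen_subrack R (\<rhd>) a \<inter> gen_subrack R (\<rhd>) c = {}"
  shows "gen_subrack R (\<rhd>) c \<subseteq> gen_subrack R (\<rhd>) d"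
proof -
  let ?L = "subrack_lattice R (\<rhd>)"
  let ?A = "gen_subrack R (\<rhd>) a" and ?C = "gen_subrack R (\<rhd>) c" and ?D = "gen_subrack R (\<rhd>) d"
  interpret distributive_lattice ?L by (rule dist)
  note sub = subrack_gen[OF aR] subrack_gen[OF cR] subrack_gen[OF dR]
  have J: "subrack (?A \<squnion>\<^bsub>?L\<^esub> ?D) R (\<rhd>)" by (intro subrack_join sub)
  have "a \<in> ?A \<squnion>\<^bsub>?L\<^esub> ?D" "d \<in> ?A \<squnion>\<^bsub>?L\<^esub> ?D"
    using Un_subset_join_subracks[OF sub(1,3)] gen_mem[of a] gen_mem[of d] by auto
  then have "?C \<subseteq> ?A \<squnion>\<^bsub>?L\<^esub> ?D" by (intro gen_least[OF J] mem[OF J])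
  then have "?C = ?C \<sqinter>\<^bsub>?L\<^esub> (?A \<squnion>\<^bsub>?L\<^esub> ?D)" using meet_subracks[OF sub(2) J] by (simp add: Int_absorb2)
  also have "\<dots> = (?C \<sqinter>\<^bsub>?L\<^esub> ?A) \<squnion>\<^bsub>?L\<^esub> (?C \<sqinter>\<^bsub>?L\<^esub> ?D)"
    using sub by (intro meet_join_distrib) (simp_all add: carrier_subrack_lattice)
  also have "\<dots> = {} \<squnion>\<^bsub>?L\<^esub> (?C \<inter> ?D)"
    using meet_subracks[OF sub(2,1)] meet_subracks[OF sub(2,3)] disj by (simp add: Int_commute)
  also have "\<dots> \<subseteq> ?D"
    by (intro join_subracks_least subrack_empty subrack_Int sub) auto
  finally show ?thesis .
qed

lemma distributive_iff_gen_op: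
  "distributive_lattice (subrack_lattice R (\<rhd>)) \<longleftrightarrow>
    (\<forall>a\<in>R. \<forall>b\<in>R. gen_subrack R (\<rhd>) (a \<rhd> b) = gen_subrack R (\<rhd>) b)" (is "?d \<longleftrightarrow> ?g")
proof
  assume d: ?d
  show ?g
  proof (intro ballI)
    fix a b assume ab: "a \<in> R" "b \<in> R"
    have abR: "a \<rhd> b \<in> R" using ab by (rule op_closed)
    show "gen_subrack R (\<rhd>) (a \<rhd> b) = gen_subrack R (\<rhd>) b"
    proof (cases "gen_subrack R (\<rhd>) a \<inter> gen_subrack R (\<rhd>) b = {} \<and>
        gen_subrack R (\<rhd>) a \<inter> gen_subrack R (\<rhd>) (a \<rhd> b) = {}")
      case True
      show ?thesis
      proof
        show "gen_subrack R (\<rhd>) (a \<rhd> b) \<subseteq> gen_subrack R (\<rhd>) b"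
        proof (rule distributive_gen_subset[OF d ab(1) abR ab(2)])
          show "a \<rhd> b \<in> Q" if "subrack Q R (\<rhd>)" "a \<in> Q" "b \<in> Q" for Q
            using that by (rule subrack_closed)
        qed (use True in simp)
        show "gen_subrack R (\<rhd>) b \<subseteq> gen_subrack R (\<rhd>) (a \<rhd> b)"
        proof (rule distributive_gen_subset[OF d ab(1,2) abR])
          show "b \<in> Q" if "subrack Q R (\<rhd>)" "a \<in> Q" "a \<rhd> b \<in> Q" for Q
            using that ab(2) by (rule subrack_div)
        qed (use True in simp)
      qed
    next
      case False
      then show ?thesis using gen_op_if_gen_meet[OF ab] gen_op_if_gen_op_meet[OF ab] by argo
    qed
  qed
next
  assume g: ?g
  interpret lattice "subrack_lattice R (\<rhd>)" by (rule lattice_subracks)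
  have Un: "subrack (A \<union> B) R (\<rhd>)" if "subrack A R (\<rhd>)" "subrack B R (\<rhd>)" for A B
    by (rule subrack_Un[OF _ that]) (use g in simp)
  have join: "A \<squnion>\<^bsub>subrack_lattice R (\<rhd>)\<^esub> B = A \<union> B" if "subrack A R (\<rhd>)" "subrack B R (\<rhd>)" for A B
    using Un_subset_join_subracks[OF that] join_subracks_least[OF that Un[OF that]]
    by (intro subset_antisym) simp_all
  show ?d
    by unfold_locales
      (simp add: carrier_subrack_lattice join meet_subracks Un subrack_Int Int_Un_distrib)
qed

end

theorem theorem2p8:
  fixes R :: "'a set" and f :: "'a \<Rightarrow> 'a \<Rightarrow> 'a"
  assumes "rack R f"
  shows "distributive_lattice (subrack_lattice R f)
    \<longleftrightarrow> trivial_quandle (corr_carrier R f) (corr_op R f)"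
proof -
  interpret rack R f by fact
  show ?thesis by (simp only: distributive_iff_gen_op trivial_corr_iff)
qed

end
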